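(* Let $0<\eta<1$ be a fixed number. For every $M<\infty$ there is a constant $C<\infty$, depending only on $M$ (for the fixed $\eta$), such that the following holds. Let $\mu$ be a positive measure on $\mathbb{R}^d$ and let $\mathcal{E}$ be a collection of measurable sets of finite $\mu$-measure such that $$\mu\bigl(\bigl\{x:\ \mathcal{M}_{\mathcal{E}}^{\mu}(\mathbbm{1}_E)(x)>\eta\bigr\}\bigr)\le M\,\mu(E)\qquad\text{for all measurable sets }E .$$ Then $$\|\mathcal{E}\|_{\mathrm{Carleson}(\mu)}\le C\,\sup\Bigl\{\frac{1}{\mu(\mathrm{sh}(\mathcal{F}))}\Bigl\|\sum_{R\in\mathcal{F}}\mathbbm{1}_R\Bigr\|_{L^{1,\infty}(\mu)}:\ \mathcal{F}\subseteq\mathcal{E}\Bigr\}.$$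
   Context: A collection (or family) is a finite unordered sequence of sets; repeated elements are allowed, and sums over a collection count multiplicity. For a collection $\mathcal{F}$, its shadow is $\mathrm{sh}(\mathcal{F})=\bigcup_{R\in\mathcal{F}}R$. The convention $\frac00=0$ is used. The Carleson constant of $\mathcal{E}$ with respect to $\mu$ is $$\|\mathcal{E}\|_{\mathrm{Carleson}(\mu)}=\sup\Bigl\{\frac{1}{\mu(\mathrm{sh}(\mathcal{F}))}\sum_{R\in\mathcal{F}}\mu(R):\ \mathcal{F}\subseteq\mathcal{E}\Bigr\}.$$ The maximal operator associated to $\mathcal{E}$ and $\mu$ is $$\mathcal{M}_{\mathcal{E}}^{\mu}f(x)=\sup_{R\in\mathcal{E}}\frac{\mathbbm{1}_R(x)}{\mu(R)}\int_R|f|\,d\mu .$$ The weak-$L^1$ quasinorm is $\|f\|_{L^{1,\infty}(\mu)}=\sup_{\lambda>0}\lambda\,\mu(\{x:|f(x)|>\lambda\})$. *)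

theory Defs
  imports "HOL-Analysis.Analysis" "HOL-Library.Multiset"
begin

text \<open>Euclidean space with the dimension as a term rather than a type, so that statements
  can assert constants that are uniform in the dimension.\<close>
definition Rspace :: "nat \<Rightarrow> (nat \<Rightarrow> real) set" where
  "Rspace d = ({..<d} \<rightarrow>\<^sub>E UNIV)"

text \<open>Repeated members are counted with multiplicity; subcollections are submultisets.\<close>
type_synonym 'a collection = "'a set multiset"

definition shadow :: "'a collection \<Rightarrow> 'a set" where
  "shadow \<F> = \<Union> (set_mset \<F>)"

definition overlap :: "'a collection \<Rightarrow> 'a \<Rightarrow> real" where
  "overlap \<F> x = (\<Sum>R\<in>#\<F>. indicator R x)"

text \<open>All quotients below are taken in \<^typ>\<open>ennreal\<close>, where \<open>0 / 0 = 0\<close>.\<close>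

definition carleson_const :: "'a measure \<Rightarrow> 'a collection \<Rightarrow> ennreal" where
  "carleson_const \<mu> \<E> =
     (SUP \<F>\<in>{\<F>. \<F> \<subseteq># \<E>}. (\<Sum>R\<in>#\<F>. emeasure \<mu> R) / emeasure \<mu> (shadow \<F>))"

definition maximal_op :: "'a measure \<Rightarrow> 'a collection \<Rightarrow> ('a \<Rightarrow> real) \<Rightarrow> 'a \<Rightarrow> ennreal" where
  "maximal_op \<mu> \<E> f x =
     (SUP R\<in>set_mset \<E>. indicator R x * (\<integral>\<^sup>+y\<in>R. ennreal \<bar>f y\<bar> \<partial>\<mu>) / emeasure \<mu> R)"

definition weak_L1 :: "'a measure \<Rightarrow> ('a \<Rightarrow> real) \<Rightarrow> ennreal" where
  "weak_L1 \<mu> f = (SUP t\<in>{0<..}. ennreal t * emeasure \<mu> {x \<in> space \<mu>. \<bar>f x\<bar> > t})"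

end

theory Submission
  imports Defs
begin

text \<open>Let \<open>K\<close> be the Carleson constant (finite, as the collection is finite) and \<open>A\<close> the supremum of
  the normalised weak norms. For \<open>\<F> \<subseteq> \<E>\<close> let \<open>S\<close> be the set where the overlap of \<open>\<F>\<close> exceeds \<open>t\<close>,
  so \<open>\<mu>(S) \<le> (A/t) \<mu>(sh \<F>)\<close>. The \<open>R \<in> \<F>\<close> with \<open>\<mu>(R \<inter> S) > \<eta> \<mu>(R)\<close> lie in
  \<open>{\<M> 1\<^sub>S > \<eta>}\<close>, so their shadow has measure at most \<open>M \<mu>(S)\<close> and their measures add up to at most
  \<open>K M \<mu>(S)\<close>. The other \<open>R\<close> have \<open>(1 - \<eta>) \<mu>(R) \<le> \<mu>(R - S)\<close>, and these measures add up to at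
  most \<open>t \<mu>(sh \<F>)\<close>. Hence \<open>K \<le> K M A / t + t / (1 - \<eta>)\<close>, and with \<open>t = 2 M A\<close> the first term
  is absorbed. (To have \<open>t > 0\<close>, one takes arbitrary \<open>a > 0\<close> with \<open>a \<ge> A\<close> in place of \<open>A\<close>,
  and \<open>M + 1\<close> in place of \<open>M\<close>.)\<close>

section \<open>Shadows and sums of measures\<close>

lemma subset_shadow: "R \<in># \<F> \<Longrightarrow> R \<subseteq> shadow \<F>"
  by (auto simp: shadow_def)

lemma sets_shadow:
  assumes "\<And>R. R \<in># \<F> \<Longrightarrow> R \<in> sets \<mu>"
  shows "shadow \<F> \<in> sets \<mu>"
  using assms by (auto simp: shadow_def)

lemma emeasure_shadow_le_sum:
  assumes "\<And>R. R \<in># \<F> \<Longrightarrow> R \<in> sets \<mu>"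
  shows "emeasure \<mu> (shadow \<F>) \<le> (\<Sum>R\<in>#\<F>. emeasure \<mu> R)"
  using assms
proof (induction \<F>)
  case empty
  then show ?case by (simp add: shadow_def)
next
  case (add R \<F>)
  have "shadow (add_mset R \<F>) = R \<union> shadow \<F>"
    by (simp add: shadow_def)
  then have "emeasure \<mu> (shadow (add_mset R \<F>)) \<le> emeasure \<mu> R + emeasure \<mu> (shadow \<F>)"
    using add.prems by (auto intro!: emeasure_subadditive sets_shadow)
  also have "\<dots> \<le> emeasure \<mu> R + (\<Sum>R\<in>#\<F>. emeasure \<mu> R)"
    using add by (intro add_left_mono) auto
  finally show ?case by simp
qed

lemma sum_emeasure_finite:
  assumes "\<And>R. R \<in># \<F> \<Longrightarrow> emeasure \<mu> R < \<infinity>"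
  shows "(\<Sum>R\<in>#\<F>. emeasure \<mu> R) < \<infinity>"
  using assms by (induction \<F>) (auto simp: less_top)

lemma sum_emeasure_le_size_mult:
  assumes "\<And>R. R \<in># \<F> \<Longrightarrow> emeasure \<mu> R \<le> b"
  shows "(\<Sum>R\<in>#\<F>. emeasure \<mu> R) \<le> of_nat (size \<F>) * b"
  using assms by (induction \<F>) (auto simp: distrib_right intro!: add_mono)

text \<open>Each member lies in the shadow. This crude count serves twice: it makes the Carleson
  constant finite, and it makes the sum vanish when the shadow is null.\<close>

lemma sum_emeasure_le_shadow:
  assumes "\<And>R. R \<in># \<F> \<Longrightarrow> R \<in> sets \<mu>"
  shows "(\<Sum>R\<in>#\<F>. emeasure \<mu> R) \<le> of_nat (size \<F>) * emeasure \<mu> (shadow \<F>)"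
  using assms by (intro sum_emeasure_le_size_mult emeasure_mono subset_shadow sets_shadow)

lemma emeasure_shadow_finite:
  assumes "\<And>R. R \<in># \<F> \<Longrightarrow> R \<in> sets \<mu>" "\<And>R. R \<in># \<F> \<Longrightarrow> emeasure \<mu> R < \<infinity>"
  shows "emeasure \<mu> (shadow \<F>) < \<infinity>"
  using emeasure_shadow_le_sum[of \<F> \<mu>] sum_emeasure_finite[of \<F> \<mu>] assms
  by (meson le_less_trans)

section \<open>Clearing denominators in the extended half-line\<close>

text \<open>Both side conditions exclude degenerate quotients: \<open>a / \<infinity>\<close> is 0,
  and for \<open>b = 0 < a\<close> the quotient is infinite, so that \<open>c = \<infinity>\<close>
  would give \<open>c * b = 0 < a\<close>.\<close>

lemma ennreal_le_mult_of_divide_le: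
  fixes a b c :: ennreal
  assumes "a / b \<le> c" "b < \<infinity>" "b = 0 \<Longrightarrow> a = 0"
  shows "a \<le> c * b"
proof (cases "b = 0")
  case False
  then have "a = a / b * b"
    using assms(2) by (simp add: ennreal_divide_times ennreal_mult_divide_eq)
  also have "\<dots> \<le> c * b"
    using assms(1) by (rule mult_right_mono) simp
  finally show ?thesis .
qed (use assms in auto)

lemma ennreal_divide_le_of_le_mult:
  fixes a b c :: ennreal
  assumes "a \<le> c * b" "b < \<infinity>"
  shows "a / b \<le> c"
proof (cases "b = 0")
  case False
  have "a / b \<le> c * b / b"
    using assms(1) by (rule divide_right_mono_ennreal)
  also have "\<dots> = c"
    using False assms(2) by (simp add: ennreal_mult_divide_eq)
  finally show ?thesis .
qed (use assms in auto)

section \<open>The Carleson constant\<close>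

text \<open>The bound by the number of members is not uniform, but finiteness is what later permits
  subtracting half of the constant from both sides.\<close>

lemma carleson_const_finite:
  assumes "\<And>R. R \<in># \<E> \<Longrightarrow> R \<in> sets \<mu>" "\<And>R. R \<in># \<E> \<Longrightarrow> emeasure \<mu> R < \<infinity>"
  shows "carleson_const \<mu> \<E> < \<infinity>"
proof -
  have "carleson_const \<mu> \<E> \<le> of_nat (size \<E>)"
    unfolding carleson_const_def
  proof (rule SUP_least)
    fix \<F> assume "\<F> \<in> {\<F>. \<F> \<subseteq># \<E>}"
    then have sub: "\<F> \<subseteq># \<E>" by simp
    have mem: "\<And>R. R \<in># \<F> \<Longrightarrow> R \<in># \<E>"
      using sub by (rule mset_subset_eqD)
    have "(\<Sum>R\<in>#\<F>. emeasure \<mu> R) \<le> of_nat (size \<F>) * emeasure \<mu> (shadow \<F>)"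
      using assms mem by (intro sum_emeasure_le_shadow) auto
    also have "\<dots> \<le> of_nat (size \<E>) * emeasure \<mu> (shadow \<F>)"
      using size_mset_mono[OF sub] by (intro mult_right_mono) auto
    finally show "(\<Sum>R\<in>#\<F>. emeasure \<mu> R) / emeasure \<mu> (shadow \<F>) \<le> of_nat (size \<E>)"
      using assms mem by (intro ennreal_divide_le_of_le_mult emeasure_shadow_finite) auto
  qed
  also have "\<dots> < \<infinity>"
    by (simp add: of_nat_less_top)
  finally show ?thesis .
qed

lemma sum_emeasure_le_carleson_const:
  assumes "\<And>R. R \<in># \<E> \<Longrightarrow> R \<in> sets \<mu>" "\<And>R. R \<in># \<E> \<Longrightarrow> emeasure \<mu> R < \<infinity>" "\<F> \<subseteq># \<E>"
  shows "(\<Sum>R\<in>#\<F>. emeasure \<mu> R) \<le> carleson_const \<mu> \<E> * emeasure \<mu> (shadow \<F>)"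
proof (rule ennreal_le_mult_of_divide_le)
  have mem: "\<And>R. R \<in># \<F> \<Longrightarrow> R \<in># \<E>"
    using assms(3) by (rule mset_subset_eqD)
  show "(\<Sum>R\<in>#\<F>. emeasure \<mu> R) / emeasure \<mu> (shadow \<F>) \<le> carleson_const \<mu> \<E>"
    unfolding carleson_const_def using assms(3) by (intro SUP_upper) simp
  show "emeasure \<mu> (shadow \<F>) < \<infinity>"
    using assms mem by (intro emeasure_shadow_finite) auto
  show "(\<Sum>R\<in>#\<F>. emeasure \<mu> R) = 0" if "emeasure \<mu> (shadow \<F>) = 0"
    using sum_emeasure_le_shadow[of \<F> \<mu>] assms(1) mem that by auto
qed

section \<open>The overlap function and its level sets\<close>

lemma overlap_nonneg: "0 \<le> overlap \<F> x"
  unfolding overlap_def by (induction \<F>) auto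

lemma overlap_add_mset: "overlap (add_mset R \<F>) x = indicator R x + overlap \<F> x"
  by (simp add: overlap_def)

lemma overlap_eq_0: "x \<notin> shadow \<F> \<Longrightarrow> overlap \<F> x = 0"
  unfolding overlap_def shadow_def by (induction \<F>) auto

lemma overlap_mono: "\<G> \<subseteq># \<F> \<Longrightarrow> overlap \<G> x \<le> overlap \<F> x"
proof -
  assume "\<G> \<subseteq># \<F>"
  then have "overlap \<F> x = overlap (\<F> - \<G> + \<G>) x"
    by simp
  also have "\<dots> = overlap (\<F> - \<G>) x + overlap \<G> x"
    unfolding overlap_def by (simp only: image_mset_union sum_mset.union)
  finally show ?thesis
    using overlap_nonneg[of "\<F> - \<G>" x] by simp
qed

lemma borel_measurable_overlap:
  assumes "\<And>R. R \<in># \<F> \<Longrightarrow> R \<in> sets \<mu>"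
  shows "overlap \<F> \<in> borel_measurable \<mu>"
  using assms
proof (induction \<F>)
  case empty
  then show ?case by (simp add: overlap_def[abs_def])
next
  case (add R \<F>)
  then have "overlap \<F> \<in> borel_measurable \<mu>" "R \<in> sets \<mu>" by auto
  then show ?case
    unfolding overlap_add_mset[abs_def] by measurable
qed

text \<open>The overlap is the sum of the indicators of the members, so this is additivity of the
  integral over the complement of \<open>S\<close>.\<close>

lemma sum_emeasure_diff:
  assumes "\<And>R. R \<in># \<F> \<Longrightarrow> R \<in> sets \<mu>" "S \<in> sets \<mu>"
  shows "(\<Sum>R\<in>#\<F>. emeasure \<mu> (R - S)) = (\<integral>\<^sup>+x. ennreal (overlap \<F> x) * indicator (- S) x \<partial>\<mu>)"
  using assms(1)
proof (induction \<F>)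
  case empty
  then show ?case by (simp add: overlap_def)
next
  case (add R \<F>)
  have [measurable]: "R \<in> sets \<mu>" "S \<in> sets \<mu>" "overlap \<F> \<in> borel_measurable \<mu>"
    using add.prems assms(2) by (auto intro: borel_measurable_overlap)
  have "(\<lambda>x. ennreal (overlap (add_mset R \<F>) x) * indicator (- S) x) =
      (\<lambda>x. indicator (R - S) x + ennreal (overlap \<F> x) * indicator (- S) x)"
    by (auto simp: overlap_add_mset overlap_nonneg ennreal_plus distrib_right indicator_def fun_eq_iff)
  moreover have "(\<integral>\<^sup>+x. indicator (R - S) x + ennreal (overlap \<F> x) * indicator (- S) x \<partial>\<mu>) =
      emeasure \<mu> (R - S) + (\<integral>\<^sup>+x. ennreal (overlap \<F> x) * indicator (- S) x \<partial>\<mu>)"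
    by (subst nn_integral_add) auto
  ultimately show ?case
    using add by simp
qed

text \<open>Off the superlevel set the overlap of \<open>\<G>\<close> is at most that of
  \<open>\<F>\<close>, hence at most \<open>t\<close>, and it vanishes off the shadow of
  \<open>\<F>\<close>; integrate. The level set is that of the larger collection
  \<open>\<F>\<close>.\<close>

lemma sum_emeasure_diff_superlevel_le:
  assumes "\<And>R. R \<in># \<F> \<Longrightarrow> R \<in> sets \<mu>" "\<G> \<subseteq># \<F>" "0 \<le> t"
  shows "(\<Sum>R\<in>#\<G>. emeasure \<mu> (R - {x \<in> space \<mu>. overlap \<F> x > t})) \<le> ennreal t * emeasure \<mu> (shadow \<F>)"
proof -
  let ?S = "{x \<in> space \<mu>. overlap \<F> x > t}"
  have [measurable]: "overlap \<F> \<in> borel_measurable \<mu>"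
    using assms by (intro borel_measurable_overlap)
  have "(\<Sum>R\<in>#\<G>. emeasure \<mu> (R - ?S)) = (\<integral>\<^sup>+x. ennreal (overlap \<G> x) * indicator (- ?S) x \<partial>\<mu>)"
    using assms mset_subset_eqD[OF assms(2)] by (intro sum_emeasure_diff) auto
  also have "\<dots> \<le> (\<integral>\<^sup>+x. ennreal t * indicator (shadow \<F>) x \<partial>\<mu>)"
  proof (rule nn_integral_mono)
    fix x assume "x \<in> space \<mu>"
    then show "ennreal (overlap \<G> x) * indicator (- ?S) x \<le> ennreal t * indicator (shadow \<F>) x"
      using overlap_mono[OF assms(2), of x] overlap_eq_0[of x \<F>] assms(3)
      by (auto simp: indicator_def ennreal_neg intro!: ennreal_leI)
  qed
  also have "\<dots> = ennreal t * emeasure \<mu> (shadow \<F>)"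
    using assms(1) by (intro nn_integral_cmult_indicator sets_shadow)
  finally show ?thesis .
qed

text \<open>The left side is one term of the supremum that defines the weak norm. A null shadow
  needs its own argument before clearing the denominator: positive superlevel sets lie in the
  shadow, so the weak norm is 0 as well.\<close>

lemma weak_type_bound_overlap:
  assumes "\<And>R. R \<in># \<F> \<Longrightarrow> R \<in> sets \<mu>" "\<And>R. R \<in># \<F> \<Longrightarrow> emeasure \<mu> R < \<infinity>"
    and "weak_L1 \<mu> (overlap \<F>) / emeasure \<mu> (shadow \<F>) \<le> A" "0 < t"
  shows "ennreal t * emeasure \<mu> {x \<in> space \<mu>. overlap \<F> x > t} \<le> A * emeasure \<mu> (shadow \<F>)"
proof -
  have "weak_L1 \<mu> (overlap \<F>) = 0" if "emeasure \<mu> (shadow \<F>) = 0"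
  proof -
    have "emeasure \<mu> {x \<in> space \<mu>. \<bar>overlap \<F> x\<bar> > s} = 0" if "0 < s" for s
    proof (rule emeasure_eq_0[OF sets_shadow])
      show "{x \<in> space \<mu>. \<bar>overlap \<F> x\<bar> > s} \<subseteq> shadow \<F>"
        using that overlap_eq_0[of _ \<F>] by force
    qed (use assms(1) \<open>emeasure \<mu> (shadow \<F>) = 0\<close> in auto)
    then show ?thesis
      by (simp add: weak_L1_def)
  qed
  then have "weak_L1 \<mu> (overlap \<F>) \<le> A * emeasure \<mu> (shadow \<F>)"
    using assms by (intro ennreal_le_mult_of_divide_le emeasure_shadow_finite)
  moreover have "ennreal t * emeasure \<mu> {x \<in> space \<mu>. \<bar>overlap \<F> x\<bar> > t} \<le> weak_L1 \<mu> (overlap \<F>)"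
    unfolding weak_L1_def using assms(4) by (intro SUP_upper) simp
  ultimately show ?thesis
    by (simp add: overlap_nonneg)
qed

section \<open>The maximal operator on indicators\<close>

text \<open>Used to make the superlevel set of the maximal function measurable;
  \<open>emeasure\<close> is 0 on non-measurable sets, so monotonicity would fail otherwise.\<close>

lemma borel_measurable_maximal_op:
  assumes "\<And>R. R \<in># \<E> \<Longrightarrow> R \<in> sets \<mu>"
  shows "maximal_op \<mu> \<E> f \<in> borel_measurable \<mu>"
  unfolding maximal_op_def[abs_def]
proof (rule borel_measurable_SUP)
  fix R assume "R \<in># \<E>"
  then have [measurable]: "R \<in> sets \<mu>" using assms by simp
  show "(\<lambda>x. indicator R x * (\<integral>\<^sup>+y\<in>R. ennreal \<bar>f y\<bar> \<partial>\<mu>) / emeasure \<mu> R) \<in> borel_measurable \<mu>"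
    by measurable
qed (simp add: countable_finite)

text \<open>The average of the indicator of \<open>S\<close> over \<open>R\<close> is the ratio of
  the measures of \<open>R \<inter> S\<close> and \<open>R\<close>, and it competes in the supremum
  at every point of \<open>R\<close>.\<close>

lemma maximal_op_indicator_gt:
  assumes "R \<in># \<E>" "R \<in> sets \<mu>" "emeasure \<mu> R < \<infinity>" "S \<in> sets \<mu>" "x \<in> R"
    and "c * emeasure \<mu> R < emeasure \<mu> (R \<inter> S)"
  shows "c < maximal_op \<mu> \<E> (indicator S) x"
proof -
  have "(\<integral>\<^sup>+y\<in>R. ennreal \<bar>indicator S y :: real\<bar> \<partial>\<mu>) = (\<integral>\<^sup>+y. indicator (R \<inter> S) y \<partial>\<mu>)"
    by (intro nn_integral_cong) (auto simp: indicator_def)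
  also have "\<dots> = emeasure \<mu> (R \<inter> S)"
    using assms by simp
  finally have int: "(\<integral>\<^sup>+y\<in>R. ennreal \<bar>indicator S y :: real\<bar> \<partial>\<mu>) = emeasure \<mu> (R \<inter> S)" .
  have le: "emeasure \<mu> (R \<inter> S) \<le> emeasure \<mu> R"
    using assms by (intro emeasure_mono) auto
  have "c < emeasure \<mu> (R \<inter> S) / emeasure \<mu> R"
  proof (rule ccontr)
    assume "\<not> c < emeasure \<mu> (R \<inter> S) / emeasure \<mu> R"
    then have "emeasure \<mu> (R \<inter> S) \<le> c * emeasure \<mu> R"
      using assms le by (intro ennreal_le_mult_of_divide_le) auto
    then show False using assms by auto
  qed
  also have "\<dots> \<le> maximal_op \<mu> \<E> (indicator S) x"
    unfolding maximal_op_def using assms int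
    by (intro SUP_upper2[of R]) auto
  finally show ?thesis .
qed

text \<open>Split \<open>R\<close> along \<open>S\<close> and move the part inside \<open>S\<close>
  to the left. All measures are finite, so the subtraction is done in the reals.\<close>

lemma emeasure_le_diff_of_inter_le:
  assumes "R \<in> sets \<mu>" "S \<in> sets \<mu>" "emeasure \<mu> R < \<infinity>" "0 < \<eta>" "\<eta> < 1"
    and "emeasure \<mu> (R \<inter> S) \<le> ennreal \<eta> * emeasure \<mu> R"
  shows "emeasure \<mu> R \<le> ennreal (1 / (1 - \<eta>)) * emeasure \<mu> (R - S)"
proof -
  have R: "emeasure \<mu> R = ennreal (measure \<mu> R)"
    using assms by (intro emeasure_eq_ennreal_measure) auto
  have fin: "emeasure \<mu> A < \<infinity>" if "A \<subseteq> R" for A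
    using emeasure_mono[OF that assms(1)] assms(3) by (rule le_less_trans)
  have I: "emeasure \<mu> (R \<inter> S) = ennreal (measure \<mu> (R \<inter> S))"
    using fin[of "R \<inter> S"] by (intro emeasure_eq_ennreal_measure) auto
  have D: "emeasure \<mu> (R - S) = ennreal (measure \<mu> (R - S))"
    using fin[of "R - S"] by (intro emeasure_eq_ennreal_measure) auto
  have "emeasure \<mu> R = emeasure \<mu> (R \<inter> S) + emeasure \<mu> (R - S)"
    using assms by (subst plus_emeasure) (auto intro!: arg_cong[of _ _ "emeasure \<mu>"])
  then have "measure \<mu> R = measure \<mu> (R \<inter> S) + measure \<mu> (R - S)"
    unfolding R I D by (simp flip: ennreal_plus)
  moreover have "measure \<mu> (R \<inter> S) \<le> \<eta> * measure \<mu> R"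
    using assms(4,6) unfolding R I by (simp flip: ennreal_mult)
  ultimately have "measure \<mu> R \<le> 1 / (1 - \<eta>) * measure \<mu> (R - S)"
    using assms(5) by (simp add: field_simps)
  then show ?thesis
    unfolding R D using assms(5) by (simp flip: ennreal_mult)
qed

section \<open>Splitting a subcollection and absorbing\<close>

text \<open>The estimate with the threshold \<open>t\<close> still free. The first coefficient comes
  from the members concentrated on the superlevel set, the second from the remaining ones.\<close>

lemma sum_emeasure_le_absorb:
  fixes \<eta> t m a :: real
  assumes "0 < \<eta>" "\<eta> < 1" "0 < t" "0 \<le> m" "0 \<le> a"
    and sets: "\<And>R. R \<in># \<E> \<Longrightarrow> R \<in> sets \<mu>" and fin: "\<And>R. R \<in># \<E> \<Longrightarrow> emeasure \<mu> R < \<infinity>"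
    and maximal: "\<And>E. E \<in> sets \<mu> \<Longrightarrow>
      emeasure \<mu> {x \<in> space \<mu>. maximal_op \<mu> \<E> (indicator E) x > ennreal \<eta>} \<le> ennreal m * emeasure \<mu> E"
    and sub: "\<F> \<subseteq># \<E>"
    and weak: "weak_L1 \<mu> (overlap \<F>) / emeasure \<mu> (shadow \<F>) \<le> ennreal a"
  shows "(\<Sum>R\<in>#\<F>. emeasure \<mu> R) \<le>
    (carleson_const \<mu> \<E> * ennreal (m * a / t) + ennreal (t / (1 - \<eta>))) * emeasure \<mu> (shadow \<F>)"
proof -
  have mem: "\<And>R. R \<in># \<F> \<Longrightarrow> R \<in># \<E>"
    using sub by (rule mset_subset_eqD)
  have F: "\<And>R. R \<in># \<F> \<Longrightarrow> R \<in> sets \<mu>" "\<And>R. R \<in># \<F> \<Longrightarrow> emeasure \<mu> R < \<infinity>"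
    using sets fin mem by auto
  define S where "S = {x \<in> space \<mu>. overlap \<F> x > t}"
  \<comment> \<open>The average of the indicator of \<open>S\<close> over \<open>R\<close> exceeds
    \<open>\<eta>\<close>, written without a quotient; null sets fail \<open>P\<close> and go to
    \<open>\<H>\<close>.\<close>
  define P where "P R \<longleftrightarrow> ennreal \<eta> * emeasure \<mu> R < emeasure \<mu> (R \<inter> S)" for R
  define \<G> where "\<G> = filter_mset P \<F>"
  define \<H> where "\<H> = filter_mset (\<lambda>R. \<not> P R) \<F>"
  have [measurable]: "overlap \<F> \<in> borel_measurable \<mu>"
    using F(1) by (rule borel_measurable_overlap)
  have S: "S \<in> sets \<mu>"
    unfolding S_def by measurable
  have GE: "\<G> \<subseteq># \<E>"
    unfolding \<G>_def using sub multiset_filter_subset subset_mset.order_trans by blast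
  let ?s = "emeasure \<mu> (shadow \<F>)"
  have "emeasure \<mu> S = ennreal (1 / t) * (ennreal t * emeasure \<mu> S)"
    using assms(3) by (simp add: mult.assoc[symmetric] ennreal_mult[symmetric])
  also have "\<dots> \<le> ennreal (1 / t) * (ennreal a * ?s)"
    unfolding S_def using assms(3) F weak by (intro mult_left_mono weak_type_bound_overlap) auto
  finally have muS: "emeasure \<mu> S \<le> ennreal (1 / t) * (ennreal a * ?s)" .
  have "shadow \<G> \<subseteq> {x \<in> space \<mu>. maximal_op \<mu> \<E> (indicator S) x > ennreal \<eta>}"
  proof
    fix x assume "x \<in> shadow \<G>"
    then obtain R where R: "R \<in># \<F>" "P R" "x \<in> R"
      by (auto simp: shadow_def \<G>_def)
    then have "ennreal \<eta> < maximal_op \<mu> \<E> (indicator S) x"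
      using F S mem unfolding P_def by (intro maximal_op_indicator_gt[of R]) auto
    moreover have "x \<in> space \<mu>"
      using R F sets.sets_into_space by blast
    ultimately show "x \<in> {x \<in> space \<mu>. maximal_op \<mu> \<E> (indicator S) x > ennreal \<eta>}"
      by simp
  qed
  moreover have "{x \<in> space \<mu>. maximal_op \<mu> \<E> (indicator S) x > ennreal \<eta>} \<in> sets \<mu>"
    using borel_measurable_maximal_op[of \<E> \<mu> "indicator S"] sets by measurable
  ultimately have "emeasure \<mu> (shadow \<G>) \<le>
      emeasure \<mu> {x \<in> space \<mu>. maximal_op \<mu> \<E> (indicator S) x > ennreal \<eta>}"
    by (rule emeasure_mono)
  also have "\<dots> \<le> ennreal m * emeasure \<mu> S"
    using S by (rule maximal)
  also have "\<dots> \<le> ennreal m * (ennreal (1 / t) * (ennreal a * ?s))"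
    using muS by (rule mult_left_mono) simp
  also have "\<dots> = ennreal (m * a / t) * ?s"
    using assms by (simp add: mult.assoc[symmetric] ennreal_mult[symmetric])
  finally have shG: "emeasure \<mu> (shadow \<G>) \<le> ennreal (m * a / t) * ?s" .
  \<comment> \<open>\<open>\<G>\<close> is itself a subcollection of \<open>\<E>\<close>, so the
    Carleson constant can be applied with its own shadow, whose size \<open>shG\<close>
    controls.\<close>
  have "(\<Sum>R\<in>#\<G>. emeasure \<mu> R) \<le> carleson_const \<mu> \<E> * emeasure \<mu> (shadow \<G>)"
    using sets fin GE by (rule sum_emeasure_le_carleson_const)
  also have "\<dots> \<le> carleson_const \<mu> \<E> * (ennreal (m * a / t) * ?s)"
    using shG by (rule mult_left_mono) simp
  finally have G: "(\<Sum>R\<in>#\<G>. emeasure \<mu> R) \<le> carleson_const \<mu> \<E> * (ennreal (m * a / t) * ?s)" .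
  have "(\<Sum>R\<in>#\<H>. emeasure \<mu> R) \<le> (\<Sum>R\<in>#\<H>. ennreal (1 / (1 - \<eta>)) * emeasure \<mu> (R - S))"
    using F S assms(1,2) unfolding \<H>_def P_def
    by (intro sum_mset_mono emeasure_le_diff_of_inter_le) auto
  also have "\<dots> = ennreal (1 / (1 - \<eta>)) * (\<Sum>R\<in>#\<H>. emeasure \<mu> (R - S))"
    by (simp add: sum_mset_distrib_left)
  \<comment> \<open>The sum is over \<open>\<H>\<close>, but \<open>S\<close> is the superlevel set
    for all of \<open>\<F>\<close>.\<close>
  also have "\<dots> \<le> ennreal (1 / (1 - \<eta>)) * (ennreal t * ?s)"
    unfolding S_def \<H>_def using F(1) assms(3)
    by (intro mult_left_mono sum_emeasure_diff_superlevel_le) auto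
  also have "\<dots> = ennreal (t / (1 - \<eta>)) * ?s"
    using assms by (simp add: mult.assoc[symmetric] ennreal_mult[symmetric])
  finally have H: "(\<Sum>R\<in>#\<H>. emeasure \<mu> R) \<le> ennreal (t / (1 - \<eta>)) * ?s" .
  have "\<F> = \<G> + \<H>"
    unfolding \<G>_def \<H>_def by (rule multiset_partition)
  then have "(\<Sum>R\<in>#\<F>. emeasure \<mu> R) = (\<Sum>R\<in>#\<G>. emeasure \<mu> R) + (\<Sum>R\<in>#\<H>. emeasure \<mu> R)"
    by simp
  also have "\<dots> \<le> carleson_const \<mu> \<E> * (ennreal (m * a / t) * ?s) + ennreal (t / (1 - \<eta>)) * ?s"
    using G H by (rule add_mono)
  finally show ?thesis
    by (simp add: distrib_right mult.assoc)
qed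

lemma carleson_const_le_of_weak_bound:
  fixes \<eta> m a :: real
  assumes "0 < \<eta>" "\<eta> < 1" "0 < m" "0 < a"
    and sets: "\<And>R. R \<in># \<E> \<Longrightarrow> R \<in> sets \<mu>" and fin: "\<And>R. R \<in># \<E> \<Longrightarrow> emeasure \<mu> R < \<infinity>"
    and maximal: "\<And>E. E \<in> sets \<mu> \<Longrightarrow>
      emeasure \<mu> {x \<in> space \<mu>. maximal_op \<mu> \<E> (indicator E) x > ennreal \<eta>} \<le> ennreal m * emeasure \<mu> E"
    and weak: "\<And>\<F>. \<F> \<subseteq># \<E> \<Longrightarrow> weak_L1 \<mu> (overlap \<F>) / emeasure \<mu> (shadow \<F>) \<le> ennreal a"
  shows "carleson_const \<mu> \<E> \<le> ennreal (4 * m / (1 - \<eta>) * a)"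
proof -
  \<comment> \<open>This choice makes \<open>m * a / t\<close> equal to 1/2.\<close>
  define t where "t = 2 * m * a"
  have t: "0 < t" using assms by (simp add: t_def)
  obtain k where k: "carleson_const \<mu> \<E> = ennreal k" "0 \<le> k"
    using carleson_const_finite[of \<E> \<mu>, OF sets fin] by (cases "carleson_const \<mu> \<E>") auto
  have "(\<Sum>R\<in>#\<F>. emeasure \<mu> R) / emeasure \<mu> (shadow \<F>) \<le> ennreal (k / 2 + t / (1 - \<eta>))"
    if sub: "\<F> \<subseteq># \<E>" for \<F>
  proof (rule ennreal_divide_le_of_le_mult)
    have "(\<Sum>R\<in>#\<F>. emeasure \<mu> R) \<le>
        (carleson_const \<mu> \<E> * ennreal (m * a / t) + ennreal (t / (1 - \<eta>))) * emeasure \<mu> (shadow \<F>)"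
      using assms t sub by (intro sum_emeasure_le_absorb) auto
    also have "carleson_const \<mu> \<E> * ennreal (m * a / t) = ennreal (k * (m * a / t))"
      unfolding k(1) using assms t k(2) by (intro ennreal_mult[symmetric]) auto
    also have "k * (m * a / t) = k / 2"
      using assms by (simp add: t_def)
    also have "ennreal (k / 2) + ennreal (t / (1 - \<eta>)) = ennreal (k / 2 + t / (1 - \<eta>))"
      using assms t k by simp
    finally show "(\<Sum>R\<in>#\<F>. emeasure \<mu> R) \<le> ennreal (k / 2 + t / (1 - \<eta>)) * emeasure \<mu> (shadow \<F>)" .
    show "emeasure \<mu> (shadow \<F>) < \<infinity>"
      using sets fin mset_subset_eqD[OF sub] by (intro emeasure_shadow_finite) auto
  qed
  then have "carleson_const \<mu> \<E> \<le> ennreal (k / 2 + t / (1 - \<eta>))"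
    unfolding carleson_const_def by (auto intro!: SUP_least)
  then have "k \<le> k / 2 + t / (1 - \<eta>)"
    using assms t k by (simp add: k(1) ennreal_le_iff del: ennreal_plus)
  \<comment> \<open>Subtract \<open>k / 2\<close> and double: \<open>2 * t / (1 - \<eta>)\<close> is
    the stated bound.\<close>
  then have "k \<le> 4 * m / (1 - \<eta>) * a"
    using assms k(2) by (simp add: t_def field_simps)
  then show ?thesis
    unfolding k(1) by (rule ennreal_leI)
qed

section \<open>Uniform constant and passage to the supremum\<close>

theorem theoremC:
  fixes \<eta> :: real
  assumes "0 < \<eta>" and "\<eta> < 1"
  shows "\<forall>M::ennreal. M < \<infinity> \<longrightarrow> (\<exists>C::ennreal. C < \<infinity> \<and>
    (\<forall>(d::nat) (\<mu> :: (nat \<Rightarrow> real) measure) (\<E> :: (nat \<Rightarrow> real) collection).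
       space \<mu> = Rspace d \<longrightarrow>
       (\<forall>R\<in>#\<E>. R \<in> sets \<mu> \<and> emeasure \<mu> R < \<infinity>) \<longrightarrow>
       (\<forall>E\<in>sets \<mu>. emeasure \<mu> {x \<in> space \<mu>. maximal_op \<mu> \<E> (indicator E) x > ennreal \<eta>}
                     \<le> M * emeasure \<mu> E) \<longrightarrow>
       carleson_const \<mu> \<E>
         \<le> C * (SUP \<F>\<in>{\<F>. \<F> \<subseteq># \<E>}. weak_L1 \<mu> (overlap \<F>) / emeasure \<mu> (shadow \<F>))))"
proof (intro allI impI)
  fix M :: ennreal assume "M < \<infinity>"
  define m where "m = enn2real M + 1"
  have m: "0 < m" "M \<le> ennreal m"
    using \<open>M < \<infinity>\<close> by (cases M; auto simp: m_def intro!: ennreal_leI)+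
  \<comment> \<open>The factor of \<open>a\<close> in
    \<open>carleson_const_le_of_weak_bound\<close>; it is built from \<open>M\<close> and
    \<open>\<eta>\<close> alone and fixed before \<open>\<mu>\<close> and
    \<open>\<E>\<close>.\<close>
  define c where "c = 4 * m / (1 - \<eta>)"
  have c: "0 < c" using m assms by (simp add: c_def)
  have main: "carleson_const \<mu> \<E> \<le>
      ennreal c * (SUP \<F>\<in>{\<F>. \<F> \<subseteq># \<E>}. weak_L1 \<mu> (overlap \<F>) / emeasure \<mu> (shadow \<F>))"
    (is "_ \<le> _ * ?A")
    if E: "\<forall>R\<in>#\<E>. R \<in> sets \<mu> \<and> emeasure \<mu> R < \<infinity>"
      and maximal: "\<forall>E\<in>sets \<mu>. emeasure \<mu> {x \<in> space \<mu>. maximal_op \<mu> \<E> (indicator E) x > ennreal \<eta>}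
                     \<le> M * emeasure \<mu> E"
    for \<mu> :: "(nat \<Rightarrow> real) measure" and \<E>
  proof -
    have *: "carleson_const \<mu> \<E> \<le> ennreal (c * a)" if "?A \<le> ennreal a" "0 < a" for a
      unfolding c_def
    proof (rule carleson_const_le_of_weak_bound)
      show "emeasure \<mu> {x \<in> space \<mu>. maximal_op \<mu> \<E> (indicator E) x > ennreal \<eta>} \<le> ennreal m * emeasure \<mu> E"
        if "E \<in> sets \<mu>" for E
        using maximal that m(2) by (meson mult_right_mono order_trans zero_le)
      show "weak_L1 \<mu> (overlap \<F>) / emeasure \<mu> (shadow \<F>) \<le> ennreal a" if "\<F> \<subseteq># \<E>" for \<F>
        using \<open>?A \<le> ennreal a\<close> that by (auto simp: SUP_le_iff)
    qed (use assms m that E in auto)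
    show ?thesis
    proof (cases ?A)
      case (real a)
      \<comment> \<open>The supremum \<open>a\<close> may be 0, while \<open>*\<close> asks for a
        positive bound. The increment \<open>e / c\<close> costs exactly \<open>e\<close> after
        multiplication by \<open>c\<close>, and \<open>e\<close> is arbitrary.\<close>
      have eps: "carleson_const \<mu> \<E> \<le> ennreal (c * a) + ennreal e" if "0 < e" for e
      proof -
        have "carleson_const \<mu> \<E> \<le> ennreal (c * (a + e / c))"
          unfolding real using real c that by (intro *) (auto intro!: ennreal_leI add_nonneg_pos)
        also have "c * (a + e / c) = c * a + e"
          using c by (simp add: field_simps)
        finally show ?thesis
          using real c that by simp
      qed
      have "carleson_const \<mu> \<E> \<le> ennreal (c * a)"
        by (rule ennreal_le_epsilon) (rule eps)
      then show ?thesis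
        unfolding real(2) using real(1) c by (simp add: ennreal_mult)
    next
      \<comment> \<open>Since \<open>c\<close> is positive, the right side is infinite.\<close>
      case top
      show ?thesis
        unfolding top using c by (simp add: ennreal_mult_top)
    qed
  qed
  show "\<exists>C::ennreal. C < \<infinity> \<and>
    (\<forall>(d::nat) (\<mu> :: (nat \<Rightarrow> real) measure) (\<E> :: (nat \<Rightarrow> real) collection).
       space \<mu> = Rspace d \<longrightarrow>
       (\<forall>R\<in>#\<E>. R \<in> sets \<mu> \<and> emeasure \<mu> R < \<infinity>) \<longrightarrow>
       (\<forall>E\<in>sets \<mu>. emeasure \<mu> {x \<in> space \<mu>. maximal_op \<mu> \<E> (indicator E) x > ennreal \<eta>}
                     \<le> M * emeasure \<mu> E) \<longrightarrow>
       carleson_const \<mu> \<E>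
         \<le> C * (SUP \<F>\<in>{\<F>. \<F> \<subseteq># \<E>}. weak_L1 \<mu> (overlap \<F>) / emeasure \<mu> (shadow \<F>)))"
    using main by (intro exI[of _ "ennreal c"] conjI allI impI ennreal_less_top[folded infinity_ennreal_def])
qed

end
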